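(* For $n\ge3$ the closed solid cylinder $Z_n=\overline B^{\,n-1}\times\mathbb{R}\subseteq\mathbb{R}^n$ (with $\overline B^{\,n-1}$ the closed unit ball of $\mathbb{R}^{n-1}$) and the closed slab $\overline\Sigma_n=\{x\in\mathbb{R}^n:0\le x_n\le1\}$ are not elementarily equivalent in $\mathcal{L}_{\mathrm{B}}$: the slab satisfies $\lambda_{n-1}$ while the cylinder fails $\lambda_2$.
   Context: $\mathcal{L}_{\mathrm{B}}$ is the first-order language with a single ternary relation symbol $B$; a convex set $K\subseteq\mathbb{R}^n$ is a structure with universe $K$, where $B(a,x,b)$ holds iff $x\in[a,b]$. Formulas: $\eta(a,b):\equiv a\ne b\wedge\exists c\,\bigl(B(a,b,c)\wedge\forall d\,(B(a,c,d)\to d=c)\bigr)$. $H_1(z;x_1):\equiv z=x_1$, $H_r(z;x_1,\dots,x_r):\equiv\exists w\,(H_{r-1}(w;x_2,\dots,x_r)\wedge B(x_1,z,w))$, and for $m\ge2$, $\operatorname{Dep}_m(x_1,\dots,x_m):\equiv\bigvee_{\{1,\dots,m\}=I\sqcup J,\ I,J\ne\emptyset}\exists z\,(H_{|I|}(z;\bar x_I)\wedge H_{|J|}(z;\bar x_J))$. For $k\ge1$, $$\lambda_k:\equiv\exists a\,\exists b_1\cdots\exists b_k\,\Bigl(\neg\operatorname{Dep}_{k+1}(a,b_1,\dots,b_k)\wedge\bigwedge_{i=1}^k\bigl(\neg\eta(a,b_i)\wedge\neg\eta(b_i,a)\bigr)\Bigr).$$ *)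

theory Defs
  imports "HOL-Analysis.Analysis"
begin

text \<open>First-order formulas over one ternary relation symbol, in de Bruijn notation: variable
  \<open>0\<close> refers to the innermost enclosing quantifier, and a variable that crosses a quantifier is
  shifted by \<open>Suc\<close>.\<close>

datatype fm =
    Fls
  | Eq nat nat
  | Btw nat nat nat
  | Neg fm
  | Con fm fm
  | Dis fm fm
  | Imp fm fm
  | Exi fm
  | Uni fm

primrec fv :: "fm \<Rightarrow> nat set" where
  "fv Fls = {}"
| "fv (Eq i j) = {i, j}"
| "fv (Btw i j k) = {i, j, k}"
| "fv (Neg p) = fv p"
| "fv (Con p q) = fv p \<union> fv q"
| "fv (Dis p q) = fv p \<union> fv q"
| "fv (Imp p q) = fv p \<union> fv q"
| "fv (Exi p) = {i. Suc i \<in> fv p}"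
| "fv (Uni p) = {i. Suc i \<in> fv p}"

definition sentence :: "fm \<Rightarrow> bool" where
  "sentence p \<longleftrightarrow> fv p = {}"

text \<open>A structure is a universe together with a ternary relation, only the restriction of which
  to the universe matters.\<close>

type_synonym 'a struct = "'a set \<times> ('a \<Rightarrow> 'a \<Rightarrow> 'a \<Rightarrow> bool)"

primrec sat :: "'a struct \<Rightarrow> (nat \<Rightarrow> 'a) \<Rightarrow> fm \<Rightarrow> bool" where
  "sat M e Fls \<longleftrightarrow> False"
| "sat M e (Eq i j) \<longleftrightarrow> e i = e j"
| "sat M e (Btw i j k) \<longleftrightarrow> snd M (e i) (e j) (e k)"
| "sat M e (Neg p) \<longleftrightarrow> \<not> sat M e p"
| "sat M e (Con p q) \<longleftrightarrow> sat M e p \<and> sat M e q"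
| "sat M e (Dis p q) \<longleftrightarrow> sat M e p \<or> sat M e q"
| "sat M e (Imp p q) \<longleftrightarrow> (sat M e p \<longrightarrow> sat M e q)"
| "sat M e (Exi p) \<longleftrightarrow> (\<exists>x\<in>fst M. sat M (case_nat x e) p)"
| "sat M e (Uni p) \<longleftrightarrow> (\<forall>x\<in>fst M. sat M (case_nat x e) p)"

text \<open>Truth in a structure is meant for sentences only; by \<open>sat_sentence\<close> below it then does not
  depend on the assignment, which therefore need not take values in the universe.\<close>

definition models :: "'a struct \<Rightarrow> fm \<Rightarrow> bool" where
  "models M p \<longleftrightarrow> (\<forall>e. sat M e p)"

definition elementarily_equivalent :: "'a struct \<Rightarrow> 'b struct \<Rightarrow> bool" where
  "elementarily_equivalent M N \<longleftrightarrow> (\<forall>p. sentence p \<longrightarrow> (models M p \<longleftrightarrow> models N p))"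

lemma sat_cong:
  assumes "\<And>i. i \<in> fv p \<Longrightarrow> e i = e' i"
  shows "sat M e p \<longleftrightarrow> sat M e' p"
  using assms
proof (induction p arbitrary: e e')
  case (Exi p)
  have "sat M (case_nat x e) p \<longleftrightarrow> sat M (case_nat x e') p" for x
    by (rule Exi.IH) (auto simp: Exi.prems split: nat.split)
  then show ?case by simp
next
  case (Uni p)
  have "sat M (case_nat x e) p \<longleftrightarrow> sat M (case_nat x e') p" for x
    by (rule Uni.IH) (auto simp: Uni.prems split: nat.split)
  then show ?case by simp
next
  case (Neg p)
  have "sat M e p \<longleftrightarrow> sat M e' p" by (rule Neg.IH) (simp add: Neg.prems)
  then show ?case by simp
next
  case (Con p q)
  have "sat M e p \<longleftrightarrow> sat M e' p" "sat M e q \<longleftrightarrow> sat M e' q"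
    by (rule Con.IH; simp add: Con.prems)+
  then show ?case by simp
next
  case (Dis p q)
  have "sat M e p \<longleftrightarrow> sat M e' p" "sat M e q \<longleftrightarrow> sat M e' q"
    by (rule Dis.IH; simp add: Dis.prems)+
  then show ?case by simp
next
  case (Imp p q)
  have "sat M e p \<longleftrightarrow> sat M e' p" "sat M e q \<longleftrightarrow> sat M e' q"
    by (rule Imp.IH; simp add: Imp.prems)+
  then show ?case by simp
qed simp_all

lemma sat_sentence: "sentence p \<Longrightarrow> sat M e p \<longleftrightarrow> models M p"
  unfolding models_def sentence_def by (metis sat_cong empty_iff)

definition segment_structure :: "'a::real_vector set \<Rightarrow> 'a struct" where
  "segment_structure K = (K, \<lambda>a x b. x \<in> closed_segment a b)"

definition Disj :: "fm list \<Rightarrow> fm" where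
  "Disj ps = foldr Dis ps Fls"

definition Conj :: "fm list \<Rightarrow> fm" where
  "Conj ps = foldr Con ps (Neg Fls)"

definition eta_fm :: "nat \<Rightarrow> nat \<Rightarrow> fm" where
  "eta_fm a b = Con (Neg (Eq a b))
    (Exi (Con (Btw (a + 1) (b + 1) 0)
              (Uni (Imp (Btw (a + 2) 1 0) (Eq 0 1)))))"

text \<open>The clause for the empty list is a dummy.\<close>

fun H_fm :: "nat \<Rightarrow> nat list \<Rightarrow> fm" where
  "H_fm z [] = Fls"
| "H_fm z [x] = Eq z x"
| "H_fm z (x # y # xs) = Exi (Con (H_fm 0 (map Suc (y # xs))) (Btw (Suc x) (Suc z) 0))"

text \<open>The members of \<open>subseqs [0..<m]\<close> list the subsets \<open>I\<close> of \<open>{0..<m}\<close>, each exactly once;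
  \<open>nths xs I\<close> is the subtuple indexed by \<open>I\<close>, and \<open>nths xs (- I)\<close> the one indexed by the
  complement.\<close>

definition Dep_fm :: "nat list \<Rightarrow> fm" where
  "Dep_fm xs = Disj
    [Exi (Con (H_fm 0 (map Suc (nths xs (set I)))) (H_fm 0 (map Suc (nths xs (- set I))))).
      I \<leftarrow> subseqs [0..<length xs], set I \<noteq> {} \<and> set I \<noteq> {0..<length xs}]"

text \<open>Below the prefix of \<open>k + 1\<close> quantifiers, \<open>a\<close> is variable \<open>k\<close> and \<open>b\<^sub>i\<close> is variable
  \<open>k - i\<close>, so that \<open>rev [0..<k + 1]\<close> is the tuple \<open>a, b\<^sub>1, \<dots>, b\<^sub>k\<close>.\<close>

definition lambda_fm :: "nat \<Rightarrow> fm" where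
  "lambda_fm k = (Exi ^^ (k + 1))
    (Con (Neg (Dep_fm (rev [0..<k + 1])))
         (Conj [Con (Neg (eta_fm k (k - i))) (Neg (eta_fm (k - i) k)). i \<leftarrow> [1..<k + 1]]))"

lemma fv_H_fm: "fv (H_fm z xs) \<subseteq> insert z (set xs)"
proof (induction z xs rule: H_fm.induct)
  case (3 z x y xs)
  then have "fv (H_fm 0 (map Suc (y # xs))) \<subseteq> insert 0 (set (map Suc (y # xs)))" by blast
  then show ?case by auto
qed auto

lemma fv_Disj: "fv (Disj ps) = (\<Union>p\<in>set ps. fv p)"
  by (induction ps) (auto simp: Disj_def)

lemma fv_Conj: "fv (Conj ps) = (\<Union>p\<in>set ps. fv p)"
  by (induction ps) (auto simp: Conj_def)

lemma fv_Dep_fm: "fv (Dep_fm xs) \<subseteq> set xs"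
  unfolding Dep_fm_def fv_Disj
  using fv_H_fm[of 0] set_nths_subset[of xs] by fastforce

lemma fv_eta_fm: "fv (eta_fm a b) = {a, b}"
  by (auto simp: eta_fm_def)

lemma fv_Exi_funpow: "fv ((Exi ^^ k) p) = {i. i + k \<in> fv p}"
  by (induction k arbitrary: p) (auto simp: funpow_Suc_right simp del: funpow.simps)

lemma sentence_lambda_fm: "sentence (lambda_fm k)"
  unfolding sentence_def lambda_fm_def fv_Exi_funpow
  using fv_Dep_fm[of "rev [0..<k + 1]"] by (auto simp: fv_Conj fv_eta_fm)

text \<open>Both sets live in \<open>\<real>\<^sup>n\<close> with \<open>n = CARD('n)\<close>; the index \<open>l\<close> plays the role of the last
  coordinate.\<close>

definition closed_cylinder :: "'n::finite \<Rightarrow> (real ^ 'n) set" where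
  "closed_cylinder l = {x. (\<Sum>i\<in>UNIV - {l}. (x $ i)\<^sup>2) \<le> 1}"

definition closed_slab :: "'n::finite \<Rightarrow> (real ^ 'n) set" where
  "closed_slab l = {x. 0 \<le> x $ l \<and> x $ l \<le> 1}"

end

theory Submission
  imports Defs
begin

text \<open>In a closed set, \<open>\<not> \<eta>(a, b)\<close> with \<open>a \<noteq> b\<close> forces the ray from \<open>a\<close> through \<open>b\<close> to meet the set at
  arbitrarily late points. In the cylinder only the rays parallel to the axis do so, hence
  \<open>a, b\<^sub>1, b\<^sub>2\<close> are collinear, and one of three collinear points lies between the other two. In the
  slab take \<open>a = 0\<close> and for the \<open>b\<^sub>i\<close> unit vectors of the hyperplane \<open>x\<^sub>l = 0\<close>: affine independence
  makes the convex hulls of disjoint subsets disjoint. This works for \<open>k = n - 1\<close> and also for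
  \<open>k = 2 \<le> n - 1\<close>, so that the sentence \<open>\<lambda>\<^sub>2\<close> separates the two structures.\<close>

section \<open>Semantics of the formulas\<close>

lemma fst_segment_structure [simp]: "fst (segment_structure K) = K"
  and snd_segment_structure [simp]: "snd (segment_structure K) a x b \<longleftrightarrow> x \<in> closed_segment a b"
  by (simp_all add: segment_structure_def)

lemma sat_Disj: "sat M e (Disj ps) \<longleftrightarrow> (\<exists>p\<in>set ps. sat M e p)"
  by (induction ps) (auto simp: Disj_def)

lemma sat_Conj: "sat M e (Conj ps) \<longleftrightarrow> (\<forall>p\<in>set ps. sat M e p)"
  by (induction ps) (auto simp: Conj_def)

text \<open>Replaces nested \<open>case_nat\<close> updates by a single assignment \<open>f\<close>,
  so that the witnesses of a quantifier prefix are supplied or obtained all at once. The induction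
  peels off the innermost quantifier, hence \<open>p\<close> is arbitrary.\<close>

lemma sat_Exi_funpow:
  "sat M e ((Exi ^^ m) p) \<longleftrightarrow>
     (\<exists>f. (\<forall>i<m. f i \<in> fst M) \<and> (\<forall>i. f (i + m) = e i) \<and> sat M f p)"
proof (induction m arbitrary: p)
  case 0
  have "f = e" if "\<forall>i. f i = e i" for f using that by auto
  then show ?case by auto
next
  case (Suc m)
  show ?case (is "?L \<longleftrightarrow> ?R")
  proof
    assume ?L
    then obtain f x where f: "\<forall>i<m. f i \<in> fst M" "\<forall>i. f (i + m) = e i"
      and x: "x \<in> fst M" "sat M (case_nat x f) p"
      using Suc[of "Exi p"] by (auto simp: funpow_Suc_right simp del: funpow.simps)
    have "\<forall>i<Suc m. case_nat x f i \<in> fst M" "\<forall>i. case_nat x f (i + Suc m) = e i"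
      using f x by (auto split: nat.split)
    with x show ?R by blast
  next
    assume ?R
    then obtain f where f: "\<forall>i<Suc m. f i \<in> fst M" "\<forall>i. f (i + Suc m) = e i" "sat M f p"
      by blast
    have "case_nat (f 0) (\<lambda>i. f (Suc i)) = f" by (auto split: nat.split)
    then have "sat M (\<lambda>i. f (Suc i)) (Exi p)" using f by (auto intro!: bexI[of _ "f 0"])
    moreover have "\<forall>i<m. f (Suc i) \<in> fst M" "\<forall>i. f (Suc (i + m)) = e i" using f by auto
    ultimately have "sat M e ((Exi ^^ m) (Exi p))" unfolding Suc
      by (intro exI[of _ "\<lambda>i. f (Suc i)"]) auto
    then show ?L by (simp add: funpow_Suc_right del: funpow.simps)
  qed
qed

text \<open>A disjunct depends on the subsequence only through its set, and these sets exhaust the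
  power set.\<close>

lemma sat_Dep_fm:
  "sat M e (Dep_fm xs) \<longleftrightarrow>
     (\<exists>I\<in>Pow {0..<length xs}. I \<noteq> {} \<and> I \<noteq> {0..<length xs} \<and>
        sat M e (Exi (Con (H_fm 0 (map Suc (nths xs I))) (H_fm 0 (map Suc (nths xs (- I)))))))"
proof -
  have "Pow {0..<length xs} = set ` set (subseqs [0..<length xs])"
    by (simp add: subseqs_powset)
  then show ?thesis
    unfolding Dep_fm_def sat_Disj by (auto simp del: sat.simps)
qed

lemma sat_eta_fm:
  "sat (segment_structure K) e (eta_fm i j) \<longleftrightarrow>
     e i \<noteq> e j \<and>
     (\<exists>c\<in>K. e j \<in> closed_segment (e i) c \<and> (\<forall>d\<in>K. c \<in> closed_segment (e i) d \<longrightarrow> d = c))"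
  by (simp add: eta_fm_def numeral_2_eq_2)

text \<open>By induction \<open>w\<close> lies in the hull of the later points, and the hull of all
  points, being convex, contains the segment from \<open>e x\<close> to \<open>w\<close>. This
  direction suffices for refuting dependence.\<close>

lemma sat_H_fm_imp_convex_hull:
  "sat (segment_structure K) e (H_fm z xs) \<Longrightarrow> e z \<in> convex hull (e ` set xs)"
proof (induction z xs arbitrary: e rule: H_fm.induct)
  case (3 z x y xs)
  let ?S = "convex hull (e ` set (x # y # xs))"
  obtain w where w: "sat (segment_structure K) (case_nat w e) (H_fm 0 (map Suc (y # xs)))"
      and z: "e z \<in> closed_segment (e x) w"
    using "3.prems" by auto
  have "w \<in> convex hull (case_nat w e ` set (map Suc (y # xs)))"
    using "3.IH"[OF w] by simp
  also have "case_nat w e ` set (map Suc (y # xs)) = e ` set (y # xs)"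
    by (simp add: image_image)
  also have "convex hull (e ` set (y # xs)) \<subseteq> ?S"
    by (rule hull_mono) auto
  finally have "w \<in> ?S" .
  moreover have "e x \<in> ?S" by (simp add: hull_inc)
  ultimately have "closed_segment (e x) w \<subseteq> ?S" by (simp add: closed_segment_subset)
  with z show ?case by blast
qed auto

lemma not_sat_Dep_fm:
  fixes e :: "nat \<Rightarrow> 'a::euclidean_space"
  assumes "distinct xs" "inj_on e (set xs)" "\<not> affine_dependent (e ` set xs)"
  shows "\<not> sat (segment_structure K) e (Dep_fm xs)"
proof
  assume "sat (segment_structure K) e (Dep_fm xs)"
  then obtain I x where
    "sat (segment_structure K) (case_nat x e) (H_fm 0 (map Suc (nths xs I)))"
    "sat (segment_structure K) (case_nat x e) (H_fm 0 (map Suc (nths xs (- I))))"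
    unfolding sat_Dep_fm by auto
  from this[THEN sat_H_fm_imp_convex_hull]
  have x: "x \<in> convex hull (e ` set (nths xs I))" "x \<in> convex hull (e ` set (nths xs (- I)))"
    by (simp_all add: image_image)
  have sub: "set (nths xs J) \<subseteq> set xs" for J by (rule set_nths_subset)
  \<comment> \<open>Distinctness separates the two lists of variables; injectivity of
    \<open>e\<close> then separates the points.\<close>
  have "set (nths xs I) \<inter> set (nths xs (- I)) = {}"
    using \<open>distinct xs\<close> by (auto simp: set_nths nth_eq_iff_index_eq)
  then have disj: "e ` set (nths xs I) \<inter> e ` set (nths xs (- I)) = {}"
    using assms(2) sub by (metis inj_on_image_Int image_empty)
  have "\<not> affine_dependent (e ` set (nths xs I) \<union> e ` set (nths xs (- I)))"
    using assms(3) by (rule affine_independent_subset) (use sub in blast)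
  \<comment> \<open>The two hulls meet in the hull of the intersection, which is empty.\<close>
  from convex_hull_Int[OF this] show False
    using x disj by auto
qed

lemma sat_Dep_fm_3:
  assumes "e i \<in> K" "e j \<in> K" "e k \<in> K" "collinear {e i, e j, e k :: 'a::euclidean_space}"
  shows "sat (segment_structure K) e (Dep_fm [i, j, k])"
proof -
  let ?xs = "[i, j, k]"
  \<comment> \<open>Split off the middle point: \<open>e x\<close> is the common point of both
    parts, and the inner witness for the pair is \<open>e z\<close>.\<close>
  have *: "sat (segment_structure K) e (Dep_fm ?xs)"
    if "p < 3" and "nths ?xs {p} = [x]" "nths ?xs (- {p}) = [y, z]"
      and "e x \<in> closed_segment (e y) (e z)" "e x \<in> K" "e z \<in> K" for p x y z
  proof -
    have "{p} \<noteq> {0..<length ?xs}"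
      by (rule notI, drule arg_cong[where f = card]) simp
    then show ?thesis
      unfolding sat_Dep_fm using that by (intro bexI[of _ "{p}"]) auto
  qed
  from assms(4) consider "e i \<in> closed_segment (e j) (e k)" | "e j \<in> closed_segment (e i) (e k)"
    | "e k \<in> closed_segment (e i) (e j)"
    unfolding collinear_between_cases between_mem_segment by (metis closed_segment_commute)
  then show ?thesis
  proof cases
    case 1 then show ?thesis using assms by (intro *[of 0 i j k]) (auto simp: nths_Cons)
  next
    case 2 then show ?thesis using assms by (intro *[of 1 j i k]) (auto simp: nths_Cons)
  next
    case 3 then show ?thesis using assms by (intro *[of 2 k i j]) (auto simp: nths_Cons)
  qed
qed

section \<open>Rays in the closed cylinder\<close>

text \<open>The parameters at which the line through \<open>a\<close> and \<open>b\<close> is in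
  \<open>K\<close> form a closed set bounded above, so their supremum is attained; it yields
  \<open>c\<close>.\<close>

lemma ray_last_point:
  fixes K :: "'a::euclidean_space set"
  assumes "closed K" "b \<in> K" "a \<noteq> b"
    and bdd: "bdd_above {t. a + t *\<^sub>R (b - a) \<in> K}"
  shows "\<exists>c\<in>K. b \<in> closed_segment a c \<and> (\<forall>d\<in>K. c \<in> closed_segment a d \<longrightarrow> d = c)"
proof -
  define T where "T = {t. a + t *\<^sub>R (b - a) \<in> K}"
  have "closed T"
    using continuous_closed_vimage[OF \<open>closed K\<close>, of "\<lambda>t. a + t *\<^sub>R (b - a)"]
    by (simp add: T_def vimage_def)
  have "1 \<in> T" using \<open>b \<in> K\<close> by (simp add: T_def)
  define t where "t = Sup T"
  define c where "c = a + t *\<^sub>R (b - a)"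
  have "t \<in> T" unfolding t_def
    using \<open>closed T\<close> \<open>1 \<in> T\<close> bdd by (intro closed_contains_Sup) (auto simp flip: T_def)
  have t_max: "s \<le> t" if "s \<in> T" for s
    unfolding t_def using that bdd by (intro cSup_upper) (auto simp: T_def)
  have "1 \<le> t" using t_max \<open>1 \<in> T\<close> by blast
  \<comment> \<open>\<open>b\<close> has parameter 1 and \<open>c\<close> has parameter
    \<open>t\<close>, which is at least 1.\<close>
  have "b = (1 - 1 / t) *\<^sub>R a + (1 / t) *\<^sub>R c"
    using \<open>1 \<le> t\<close> by (simp add: c_def algebra_simps)
  then have "b \<in> closed_segment a c"
    using \<open>1 \<le> t\<close> unfolding in_segment by (intro exI[of _ "1 / t"]) auto
  moreover have "d = c" if "d \<in> K" "c \<in> closed_segment a d" for d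
  proof -
    from that obtain u where u: "0 \<le> u" "u \<le> 1" "c = (1 - u) *\<^sub>R a + u *\<^sub>R d"
      unfolding in_segment by blast
    then have ud: "u *\<^sub>R (d - a) = t *\<^sub>R (b - a)" by (simp add: c_def algebra_simps)
    have "u \<noteq> 0" using ud \<open>1 \<le> t\<close> \<open>a \<noteq> b\<close> by auto
    have "d - a = (1 / u) *\<^sub>R (u *\<^sub>R (d - a))" using \<open>u \<noteq> 0\<close> by simp
    \<comment> \<open>\<open>d\<close> has parameter \<open>t / u\<close>, so maximality of
      \<open>t\<close> leaves only \<open>u = 1\<close>.\<close>
    then have "d = a + (t / u) *\<^sub>R (b - a)" unfolding ud by (simp add: algebra_simps)
    then have "t / u \<le> t" using t_max \<open>d \<in> K\<close> by (simp add: T_def)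
    then have "u = 1" using \<open>u \<noteq> 0\<close> u \<open>1 \<le> t\<close> by (simp add: field_simps)
    then show "d = c" using u by simp
  qed
  ultimately show ?thesis using \<open>t \<in> T\<close> by (auto simp: T_def c_def)
qed

lemma closed_closed_cylinder: "closed (closed_cylinder l)"
  unfolding closed_cylinder_def by (intro closed_Collect_le continuous_intros)

lemma abs_nth_closed_cylinder_le:
  assumes "x \<in> closed_cylinder l" "i \<noteq> l"
  shows "\<bar>x $ i\<bar> \<le> 1"
proof -
  have "(x $ i)\<^sup>2 \<le> (\<Sum>i\<in>UNIV - {l}. (x $ i)\<^sup>2)"
    using assms by (intro member_le_sum) auto
  also have "\<dots> \<le> 1" using assms by (simp add: closed_cylinder_def)
  finally show ?thesis by (simp add: abs_square_le_1)
qed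

text \<open>Otherwise coordinate \<open>k\<close> changes linearly along the ray while it must stay
  in [-1, 1]; this bounds the parameter, and \<open>ray_last_point\<close> gives \<eta>.\<close>

lemma not_eta_closed_cylinder:
  assumes "\<not> sat (segment_structure (closed_cylinder l)) e (eta_fm i j)"
    and "e j \<in> closed_cylinder l" "k \<noteq> l"
  shows "e j $ k = e i $ k"
proof (rule ccontr)
  assume neq: "e j $ k \<noteq> e i $ k"
  let ?v = "e j - e i"
  have "t \<le> (1 + \<bar>e i $ k\<bar>) / \<bar>?v $ k\<bar>" if "e i + t *\<^sub>R ?v \<in> closed_cylinder l" for t
  proof -
    have "\<bar>e i $ k + t * ?v $ k\<bar> \<le> 1"
      using abs_nth_closed_cylinder_le[OF that \<open>k \<noteq> l\<close>] by simp
    then have "\<bar>t\<bar> * \<bar>?v $ k\<bar> \<le> 1 + \<bar>e i $ k\<bar>" unfolding abs_mult[symmetric] by linarith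
    then have "\<bar>t\<bar> \<le> (1 + \<bar>e i $ k\<bar>) / \<bar>?v $ k\<bar>" using neq by (simp add: pos_le_divide_eq)
    then show ?thesis by linarith
  qed
  then have "bdd_above {t. e i + t *\<^sub>R ?v \<in> closed_cylinder l}" by (auto intro!: bdd_aboveI)
  moreover have "e i \<noteq> e j" using neq by auto
  ultimately show False
    using assms(1) ray_last_point[OF closed_closed_cylinder assms(2)] by (simp add: sat_eta_fm)
qed

lemma not_models_closed_cylinder_lambda_2:
  "\<not> models (segment_structure (closed_cylinder l)) (lambda_fm 2)"
proof
  let ?M = "segment_structure (closed_cylinder l)"
  assume "models ?M (lambda_fm 2)"
  then have "sat ?M undefined (lambda_fm 2)" by (simp add: models_def)
  \<comment> \<open>Variable 2 is \<open>a\<close>; variables 1 and 0 are the two points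
    \<open>b\<close>.\<close>
  moreover have "rev [0..<2 + 1] = [2, 1, 0]" "[1..<2 + 1] = [1, 2]"
    by (simp_all add: upt_rec)
  ultimately obtain e where K: "\<forall>i<3. e i \<in> closed_cylinder l"
    and ndep: "\<not> sat ?M e (Dep_fm [2, 1, 0])"
    and eta: "\<not> sat ?M e (eta_fm 2 1)" "\<not> sat ?M e (eta_fm 2 0)"
    unfolding lambda_fm_def sat_Exi_funpow by (auto simp: sat_Conj simp del: set_upt)
  have coord: "e i $ k = e 2 $ k" if "i \<in> {2, 1, 0}" "k \<noteq> l" for i k
    using not_eta_closed_cylinder[of l e 2 i k] that eta K by auto
  have "e i - e j = (e i - e j) $ l *\<^sub>R axis l 1" if "i \<in> {2, 1, 0}" "j \<in> {2, 1, 0}" for i j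
  proof -
    have "e i $ k = e j $ k" if "k \<noteq> l" for k
      using coord[OF \<open>i \<in> _\<close> that] coord[OF \<open>j \<in> _\<close> that] by (rule trans[OF _ sym])
    then show ?thesis by (simp add: vec_eq_iff axis_def)
  qed
  then have "collinear (e ` {2, 1, 0})"
    unfolding collinear_def by blast
  then have "collinear {e 2, e 1, e 0}" by simp
  with ndep K show False by (simp add: sat_Dep_fm_3)
qed

section \<open>The closed slab\<close>

lemma not_eta_closed_slab:
  assumes "e i $ l = 0" "e j $ l = 0"
  shows "\<not> sat (segment_structure (closed_slab l)) e (eta_fm i j)"
proof
  assume "sat (segment_structure (closed_slab l)) e (eta_fm i j)"
  then obtain c where "e i \<noteq> e j" "c \<in> closed_slab l" and j: "e j \<in> closed_segment (e i) c"
    and c: "\<And>d. d \<in> closed_slab l \<Longrightarrow> c \<in> closed_segment (e i) d \<Longrightarrow> d = c"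
    unfolding sat_eta_fm by blast
  from j obtain u where u: "e j = (1 - u) *\<^sub>R e i + u *\<^sub>R c" unfolding in_segment by blast
  with \<open>e i \<noteq> e j\<close> have "u \<noteq> 0" "c \<noteq> e i" by (auto simp: algebra_simps)
  \<comment> \<open>Coordinate \<open>l\<close> of \<open>u *\<^sub>R c\<close> vanishes, so
    \<open>c\<close> stays in the hyperplane.\<close>
  have "c $ l = 0" using u assms \<open>u \<noteq> 0\<close> by (auto simp: vec_eq_iff dest: spec[of _ l])
  \<comment> \<open>The reflection of \<open>e i\<close> in \<open>c\<close> is a point of the same
    hyperplane beyond \<open>c\<close>.\<close>
  define d where "d = 2 *\<^sub>R c - e i"
  have "d \<in> closed_slab l" using \<open>c $ l = 0\<close> assms by (simp add: closed_slab_def d_def)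
  moreover have "c \<in> closed_segment (e i) d"
    unfolding in_segment by (intro exI[of _ "1/2"]) (simp add: d_def algebra_simps)
  ultimately have "d = c" by (rule c)
  then have "c = e i" by (simp add: d_def scaleR_2 algebra_simps)
  with \<open>c \<noteq> e i\<close> show False ..
qed

lemma models_closed_slab_lambda:
  fixes l :: "'n::finite"
  assumes "k < CARD('n)"
  shows "models (segment_structure (closed_slab l)) (lambda_fm k)"
proof -
  let ?M = "segment_structure (closed_slab l)"
  have "sat ?M e (lambda_fm k)" for e
  proof -
    \<comment> \<open>\<open>g\<close> selects \<open>k\<close> distinct coordinates other than
      \<open>l\<close>.\<close>
    have "card {..<k} \<le> card (UNIV - {l})" using assms by simp
    then obtain g where g: "g ` {..<k} \<subseteq> UNIV - {l}" "inj_on g {..<k}"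
      using card_le_inj[of "{..<k}" "UNIV - {l}"] by auto
    \<comment> \<open>Variable \<open>k\<close> is the origin, smaller ones are unit vectors; beyond
      the \<open>k + 1\<close> quantifiers the outer assignment \<open>e\<close> resumes.\<close>
    define f where "f i = (if i < k then axis (g i) 1 else if i = k then 0 else e (i - Suc k))" for i
    have f_l: "f i $ l = 0" if "i \<le> k" for i
      using that g(1) by (force simp: f_def axis_def)
    have "inj_on f {..k}"
      using g by (auto simp: inj_on_def f_def axis_eq_axis)
    moreover have "\<not> affine_dependent (f ` {..k})"
    proof -
      have "f ` {..k} = insert 0 ((\<lambda>i. axis (g i) 1) ` {..<k})"
        by (auto simp: f_def image_iff less_le)
      moreover have "independent ((\<lambda>i. axis (g i) (1::real)) ` {..<k})"
        by (rule independent_mono[OF independent_Basis]) auto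
      moreover have "0 \<notin> (\<lambda>i. axis (g i) (1::real)) ` {..<k}"
        by auto
      \<comment> \<open>With 0 as base point, affine independence is linear independence of the unit
        vectors.\<close>
      ultimately show ?thesis
        by (simp add: affine_dependent_iff_dependent)
    qed
    moreover have "set (rev [0..<k + 1]) = {..k}" by auto
    ultimately have "\<not> sat ?M f (Dep_fm (rev [0..<k + 1]))"
      by (intro not_sat_Dep_fm) (simp_all del: upt_Suc)
    moreover have "\<not> sat ?M f (eta_fm k (k - i))" "\<not> sat ?M f (eta_fm (k - i) k)" for i
      by (simp_all add: not_eta_closed_slab f_l)
    moreover have "\<forall>i<k + 1. f i \<in> closed_slab l" using f_l by (simp add: closed_slab_def)
    moreover have "\<forall>i. f (i + (k + 1)) = e i" by (simp add: f_def)
    ultimately show ?thesis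
      unfolding lambda_fm_def sat_Exi_funpow
      by (intro exI[of _ f]) (simp add: sat_Conj del: upt_Suc)
  qed
  then show ?thesis by (simp add: models_def)
qed

theorem corollary10p12:
  fixes n :: nat and l :: "'n::finite"
  assumes "CARD('n) = n" and "n \<ge> 3"
  shows "\<not> elementarily_equivalent
            (segment_structure (closed_cylinder l)) (segment_structure (closed_slab l))
       \<and> models (segment_structure (closed_slab l)) (lambda_fm (n - 1))
       \<and> \<not> models (segment_structure (closed_cylinder l)) (lambda_fm 2)"
proof -
  \<comment> \<open>The second instance, where \<open>2 < n\<close> enters, provides the separating
    sentence.\<close>
  have "models (segment_structure (closed_slab l)) (lambda_fm (n - 1))"
    and "models (segment_structure (closed_slab l)) (lambda_fm 2)"
    using assms by (intro models_closed_slab_lambda; simp)+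
  then show ?thesis
    using not_models_closed_cylinder_lambda_2[of l] sentence_lambda_fm[of 2]
    unfolding elementarily_equivalent_def by blast
qed

end
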